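(* Let $n,m\ge1$ and $0<t_1<t_2<\cdots<t_m<1$. For $i=1,\ldots,m$ let $$v_j^{(n+i)}:=\langle t^j,(t-t_i)_+^n\rangle_L\ (0\le j\le n),\qquad v_{n+j}^{(n+i)}:=\langle(t-t_j)_+^n,(t-t_i)_+^n\rangle_L\ (1\le j\le i).$$ Then $$v_j^{(n+i)}=\frac{(1-t_i)^{n+1}t_i^j}{n+1}\,{}_2F_1\!\left(-j,n+1;n+2;\tfrac{t_i-1}{t_i}\right)\ (0\le j\le n),\qquad v_{n+i}^{(n+i)}=\frac{(1-t_i)^{2n+1}}{2n+1},$$ $$v_{n+j}^{(n+i)}=v_{n+i}^{(n+i)}\,{}_2F_1\!\left(-n,-2n-1;-2n;\tfrac{t_i-t_j}{t_i-1}\right)\ (1\le j\le i-1).$$ Moreover, define $\Psi_{k,j}^{(0)}:=\Phi_{k,j}:=(2k+1)(-k)_j(k+1)_j(j!)^{-2}$ for $j,k=0,1,\ldots,n$ and, recursively for $i=1,2,\ldots,m$, $$u_j^{(n+i)}:=\sum_{k=0}^n\Psi_{k,j}^{(i-1)}\sum_{q=0}^k(-k)_q(k+1)_q(q!)^{-2}v_q^{(n+i)}+\sum_{h=1}^{i-1}\Lambda_{h,j}^{(i-1)}v_{n+h}^{(n+i)}\quad(0\le j\le n+i-1),$$ $$c_{n+i}^{(n+i)}:=\Big(v_{n+i}^{(n+i)}-\sum_{h=0}^{n+i-1}v_h^{(n+i)}u_h^{(n+i)}\Big)^{-1},\qquad c_h^{(n+i)}:=-v_h^{(n+i)}c_{n+i}^{(n+i)}\quad(0\le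 h\le n+i-1),$$ $$\Psi_{k,n+i}^{(i)}:=\sum_{l=0}^{n+i-1}c_l^{(n+i)}\Psi_{k,l}^{(i-1)},\qquad \Psi_{k,j}^{(i)}:=\Psi_{k,j}^{(i-1)}-u_j^{(n+i)}\Psi_{k,n+i}^{(i)}\quad(0\le j\le n+i-1;\ 0\le k\le n),$$ $$\Lambda_{h,n+i}^{(i)}:=\sum_{l=0}^{n+i-1}c_l^{(n+i)}\Lambda_{h,l}^{(i-1)},\qquad \Lambda_{h,j}^{(i)}:=\Lambda_{h,j}^{(i-1)}-u_j^{(n+i)}\Lambda_{h,n+i}^{(i)}\quad(0\le j\le n+i-1;\ 1\le h\le i-1),$$ $$\Lambda_{i,n+i}^{(i)}:=c_{n+i}^{(n+i)},\qquad \Lambda_{i,j}^{(i)}:=-u_j^{(n+i)}\Lambda_{i,n+i}^{(i)}\quad(0\le j\le n+i-1).$$ Then for each $i=1,\ldots,m$ the functions $$d_j^{(n+i)}(t)=\sum_{k=0}^n\Psi_{k,j}^{(i)}L_{k,n}(t)+\sum_{h=1}^i\Lambda_{h,j}^{(i)}(t-t_h)_+^n\qquad(j=0,1,\ldots,n+i)$$ form the dual basis, with respect to $\langle\cdot,\cdot\rangle_L$, for the truncated power basis $1,t,\ldots,t^n,(t-t_1)_+^n,\ldots,(t-t_i)_+^n$ of the spline space it spans; i.e., writing $b_l=t^l$ $(0\le l\le n)$ and $b_{n+l}=(t-t_l)_+^n$ $(1\le l\le i)$, the $d_j^{(n+i)}$ span the same space as $b_0,\ldots,b_{n+i}$ and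 $\langle b_l,d_j^{(n+i)}\rangle_L=\delta_{l,j}$ for $l,j=0,1,\ldots,n+i$.
   Context: $\langle f,g\rangle_L=\int_0^1f(t)g(t)\,dt$. $(x-t)_+^n=(x-t)^n$ if $x>t$ and $0$ if $x\le t$. $L_{k,n}(t)=\frac{1}{k!}\frac{d^k}{dt^k}\big[(1-t)^kt^k\big]$ $(k=0,\ldots,n)$ are the shifted Legendre polynomials. Pochhammer symbol: $(h)_0=1$, $(h)_k=h(h+1)\cdots(h+k-1)$. For a nonnegative integer $s$, ${}_2F_1(-s,a;b;t)=\sum_{k=0}^s\frac{(-s)_k(a)_k}{(b)_kk!}t^k$. Empty sums are $0$. $\delta_{l,j}$ is the Kronecker delta. *)

theory Defs
  imports "HOL-Analysis.Analysis" "HOL-Library.Function_Algebras"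
begin

definition inner_L :: "(real \<Rightarrow> real) \<Rightarrow> (real \<Rightarrow> real) \<Rightarrow> real" where
  "inner_L f g = integral {0..1} (\<lambda>x. f x * g x)"

definition trunc_pow :: "nat \<Rightarrow> real \<Rightarrow> real \<Rightarrow> real" where
  "trunc_pow n s x = (if x > s then (x - s) ^ n else 0)"

text \<open>\<open>L\<^sub>k\<^sub>,\<^sub>n\<close> does not depend on \<open>n\<close>, so only the degree \<open>k\<close> is kept.\<close>

definition shifted_legendre :: "nat \<Rightarrow> real \<Rightarrow> real" where
  "shifted_legendre k x = 1 / fact k * (deriv ^^ k) (\<lambda>y. (1 - y) ^ k * y ^ k) x"

text \<open>\<open>hyp2F1 s a b x\<close> is the terminating series with upper parameters \<open>-s\<close> and \<open>a\<close>:
  the first argument is \<open>s\<close>, not \<open>-s\<close>.  Summing only up to \<open>s\<close> matters when \<open>b\<close> is a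
  nonpositive integer, since the later terms have a vanishing denominator.\<close>

definition hyp2F1 :: "nat \<Rightarrow> real \<Rightarrow> real \<Rightarrow> real \<Rightarrow> real" where
  "hyp2F1 s a b x =
     (\<Sum>k=0..s. pochhammer (- real s) k * pochhammer a k / (pochhammer b k * fact k) * x ^ k)"

text \<open>The knots are \<open>t 1, t 2, \<dots>\<close>; \<open>tp_basis n t l\<close> is \<open>x \<mapsto> x\<^sup>l\<close> for \<open>l \<le> n\<close> and the
  truncated power at the knot \<open>t (l - n)\<close> for \<open>l > n\<close>.\<close>

definition tp_basis :: "nat \<Rightarrow> (nat \<Rightarrow> real) \<Rightarrow> nat \<Rightarrow> real \<Rightarrow> real" where
  "tp_basis n t l = (if l \<le> n then (\<lambda>x. x ^ l) else trunc_pow n (t (l - n)))"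

text \<open>Below, an upper index \<open>(n+i)\<close> or \<open>(i)\<close> becomes the argument \<open>i\<close>;
  so \<open>vv n t i j\<close> is \<open>v\<^sub>j\<close> with upper index \<open>(n+i)\<close>.\<close>

definition vv :: "nat \<Rightarrow> (nat \<Rightarrow> real) \<Rightarrow> nat \<Rightarrow> nat \<Rightarrow> real" where
  "vv n t i j = inner_L (tp_basis n t j) (trunc_pow n (t i))"

definition Phi :: "nat \<Rightarrow> nat \<Rightarrow> real" where
  "Phi k j = (2 * real k + 1) * pochhammer (- real k) j * pochhammer (real k + 1) j / (fact j)\<^sup>2"

text \<open>The coefficients at level \<open>Suc i\<close> are computed from the tables \<open>Psi\<close>, \<open>Lam\<close> at level \<open>i\<close>;
  \<open>cc_last n t i\<close> is \<open>c\<^sub>n\<^sub>+\<^sub>i\<close>.  In the branches \<open>j \<noteq> n + Suc i\<close> the sum multiplied by \<open>uu\<close> is the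
  new entry with index \<open>n + Suc i\<close>, written out.  Values outside the index ranges \<open>k \<le> n\<close>, \<open>1 \<le> h \<le> i\<close>, \<open>j \<le> n + i\<close> are junk and never
  used, as are \<open>uu\<close> and \<open>cc\<close> at level \<open>0\<close>.  The reciprocal in \<open>cc_last\<close> is total
  (\<open>inverse 0 = 0\<close>); a zero argument would make every coefficient of the new dual function
  vanish, contradicting biorthogonality, so nonvanishing is part of what biorthogonality asserts.\<close>

function (sequential)
  Psi :: "nat \<Rightarrow> (nat \<Rightarrow> real) \<Rightarrow> nat \<Rightarrow> nat \<Rightarrow> nat \<Rightarrow> real" and
  Lam :: "nat \<Rightarrow> (nat \<Rightarrow> real) \<Rightarrow> nat \<Rightarrow> nat \<Rightarrow> nat \<Rightarrow> real" and
  uu :: "nat \<Rightarrow> (nat \<Rightarrow> real) \<Rightarrow> nat \<Rightarrow> nat \<Rightarrow> real" and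
  cc_last :: "nat \<Rightarrow> (nat \<Rightarrow> real) \<Rightarrow> nat \<Rightarrow> real" and
  cc :: "nat \<Rightarrow> (nat \<Rightarrow> real) \<Rightarrow> nat \<Rightarrow> nat \<Rightarrow> real"
where
  "Psi n t 0 k j = Phi k j"
| "Psi n t (Suc i) k j =
     (if j = n + Suc i then (\<Sum>l=0..n+i. cc n t (Suc i) l * Psi n t i k l)
      else Psi n t i k j
             - uu n t (Suc i) j * (\<Sum>l=0..n+i. cc n t (Suc i) l * Psi n t i k l))"
| "Lam n t 0 h j = 0"
| "Lam n t (Suc i) h j =
     (if h = Suc i then
        (if j = n + Suc i then cc n t (Suc i) (n + Suc i)
         else - uu n t (Suc i) j * cc n t (Suc i) (n + Suc i))
      else
        (if j = n + Suc i then (\<Sum>l=0..n+i. cc n t (Suc i) l * Lam n t i h l)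
         else Lam n t i h j
                - uu n t (Suc i) j * (\<Sum>l=0..n+i. cc n t (Suc i) l * Lam n t i h l)))"
| "uu n t 0 j = 0"
| "uu n t (Suc i) j =
     (\<Sum>k=0..n. Psi n t i k j *
        (\<Sum>q=0..k. pochhammer (- real k) q * pochhammer (real k + 1) q / (fact q)\<^sup>2
                      * vv n t (Suc i) q))
     + (\<Sum>h=1..i. Lam n t i h j * vv n t (Suc i) (n + h))"
| "cc_last n t 0 = 0"
| "cc_last n t (Suc i) =
     inverse (vv n t (Suc i) (n + Suc i) - (\<Sum>h=0..n+i. vv n t (Suc i) h * uu n t (Suc i) h))"
| "cc n t i h = (if h = n + i then cc_last n t i else - vv n t i h * cc_last n t i)"
  by pat_completeness auto

termination
  by (relation "measures
       [\<lambda>x. case x of Inl (Inl (n, t, i, k, j)) \<Rightarrow> i | Inl (Inr (n, t, i, h, j)) \<Rightarrow> i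
          | Inr (Inl (n, t, i, j)) \<Rightarrow> i | Inr (Inr (Inl (n, t, i))) \<Rightarrow> i
          | Inr (Inr (Inr (n, t, i, h))) \<Rightarrow> i,
        \<lambda>x. case x of Inl _ \<Rightarrow> 3 | Inr (Inl _) \<Rightarrow> 0 | Inr (Inr (Inl _)) \<Rightarrow> 1
          | Inr (Inr (Inr _)) \<Rightarrow> 2]") auto

definition dual_fun :: "nat \<Rightarrow> (nat \<Rightarrow> real) \<Rightarrow> nat \<Rightarrow> nat \<Rightarrow> real \<Rightarrow> real" where
  "dual_fun n t i j x =
     (\<Sum>k=0..n. Psi n t i k j * shifted_legendre k x)
     + (\<Sum>h=1..i. Lam n t i h j * trunc_pow n (t h) x)"

text \<open>Real-valued functions form a real vector space under pointwise scaling; \<open>rfun.span\<close> is the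
  linear span in that space.\<close>

definition rfun_scale :: "real \<Rightarrow> (real \<Rightarrow> real) \<Rightarrow> real \<Rightarrow> real" where
  "rfun_scale c f = (\<lambda>x. c * f x)"

global_interpretation rfun: vector_space rfun_scale
  by unfold_locales (auto simp: rfun_scale_def algebra_simps fun_eq_iff)

end

theory Submission
  imports Defs
begin

text \<open>
The closed forms of the \<open>vv\<close> are binomial expansions: to the right of the knot \<open>t i\<close> every basis
function that precedes the truncated power at \<open>t i\<close>, and that function itself, is a power
\<open>(x - r)\<^sup>j\<close>.  Expanding it around \<open>t i\<close> and integrating termwise
(\<open>inner_L_power_trunc_pow\<close>) gives terminating series with factors \<open>a / (a + k)\<close>, which are the
stated hypergeometric sums (\<open>hyp2F1_contiguous\<close>).

Biorthogonality is an induction on the number of knots.  Without knots, the dual functions are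
the Legendre expansions of the dual basis of the monomials; the claim says that the triangular
matrix of Legendre coefficients cancels, given the orthogonality of the Legendre polynomials
with squared norms \<open>1 / (2 k + 1)\<close> (\<open>legendre_orthogonal\<close>, \<open>dual_fun_0_biorthogonal\<close>).  Adding
a knot is a Gram-Schmidt step: \<open>uu\<close> collects the inner products of the new truncated power \<open>g\<close>
with the old dual functions (\<open>uu_eq_inner_L\<close>), the new dual function is the normalised residual
\<open>g - p\<close> of the orthogonal projection \<open>p\<close> of \<open>g\<close> onto the old spline space
(\<open>dual_fun_Suc_new\<close>), and the old dual functions are made orthogonal to \<open>g\<close> by subtracting
multiples of it (\<open>dual_fun_Suc_old\<close>, \<open>biorthogonal_extend\<close>).

The point that needs an argument is that the normalising factor is the reciprocal of a nonzero
number.  That number is the squared norm of \<open>g - p\<close> (\<open>residual_nonzero\<close>), and \<open>g\<close> is not equal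
on \<open>[0, 1]\<close> to any spline with the earlier knots (\<open>trunc_pow_not_spline\<close>).  The equality of the
spans follows from biorthogonality by counting dimensions (\<open>span_eq_of_biorthogonal\<close>).
\<close>

section \<open>Moments of truncated powers\<close>

lemma pochhammer_minus_of_nat_over_fact:
  "pochhammer (- real s) k / fact k = (- 1) ^ k * real (s choose k)"
proof -
  have "real (s choose k) = (- 1) ^ k * (pochhammer (- real s) k / fact k)"
    by (simp add: binomial_gbinomial gbinomial_pochhammer)
  then show ?thesis by (simp add: power_mult_distrib[symmetric] flip: mult.assoc)
qed

text \<open>With lower parameter \<open>a + 1\<close> the quotient of Pochhammer symbols telescopes to
\<open>a / (a + k)\<close>, the kind of factor that arises when powers are integrated.  The
nonvanishing of \<open>a + k\<close> is demanded only up to \<open>s\<close>, so that \<open>a = - 2 n - 1\<close> with \<open>s = n\<close>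
is admissible although \<open>a + 1\<close> is a negative integer.\<close>

lemma hyp2F1_contiguous:
  assumes "\<And>k. k \<le> s \<Longrightarrow> a + real k \<noteq> 0"
  shows "hyp2F1 s a (a + 1) x = (\<Sum>k=0..s. real (s choose k) * (a / (a + real k)) * (- x) ^ k)"
  unfolding hyp2F1_def
proof (rule sum.cong, rule refl)
  fix k assume "k \<in> {0..s}"
  then have k: "k \<le> s" by simp
  have "pochhammer (a + 1) k \<noteq> 0"
  proof
    assume "pochhammer (a + 1) k = 0"
    then obtain j where "j < k" "a + 1 = - real j"
      by (auto simp: pochhammer_eq_0_iff)
    then show False using assms[of "Suc j"] k by simp
  qed
  moreover have "a * pochhammer (a + 1) k = (a + real k) * pochhammer a k"
    using pochhammer_rec[of a k] pochhammer_rec'[of a k] by simp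
  ultimately have "pochhammer a k / pochhammer (a + 1) k = a / (a + real k)"
    using assms[OF k] by (simp add: field_simps)
  moreover have "pochhammer (- real s) k / fact k = (- 1) ^ k * real (s choose k)"
    by (rule pochhammer_minus_of_nat_over_fact)
  moreover have "pochhammer (- real s) k * pochhammer a k / (pochhammer (a + 1) k * fact k) =
      (pochhammer (- real s) k / fact k) * (pochhammer a k / pochhammer (a + 1) k)"
    by (simp add: mult_ac)
  moreover have "(- x) ^ k = (- 1) ^ k * x ^ k"
    by (simp flip: power_mult_distrib)
  ultimately show "pochhammer (- real s) k * pochhammer a k / (pochhammer (a + 1) k * fact k) * x ^ k
      = real (s choose k) * (a / (a + real k)) * (- x) ^ k"
    by simp
qed

text \<open>All entries of the table \<open>vv\<close> are instances: \<open>r = 0\<close> gives the monomials, an earlier knot \<open>r\<close>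
gives the mixed products of truncated powers, and \<open>r = s\<close> the diagonal.  Only \<open>[s, 1]\<close>
contributes, and there \<open>x - r = (x - s) + (s - r)\<close> is expanded binomially and integrated
termwise.\<close>

lemma inner_L_power_trunc_pow:
  fixes s r :: real
  assumes "0 \<le> s" "s \<le> 1" and f: "\<And>x. s < x \<Longrightarrow> f x = (x - r) ^ j"
  shows "inner_L f (trunc_pow n s) =
    (\<Sum>k=0..j. real (j choose k) * (s - r) ^ (j - k) * ((1 - s) ^ (n + k + 1) / real (n + k + 1)))"
proof -
  define c where "c k = real (j choose k) * (s - r) ^ (j - k)" for k
  define F where "F x = (\<Sum>k=0..j. c k * ((x - s) ^ (n + k + 1) / real (n + k + 1)))" for x
  have left: "((\<lambda>x. f x * trunc_pow n s x) has_integral 0) {0..s}"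
    by (rule has_integral_is_0) (auto simp: trunc_pow_def)
  \<comment> \<open>At \<open>x = s\<close> itself this fails for \<open>n = 0\<close>; a single point is negligible.\<close>
  have integrand: "f x * trunc_pow n s x = (\<Sum>k=0..j. c k * (x - s) ^ (n + k))" if "x \<in> {s..1} - {s}" for x
  proof -
    have "(x - r) ^ j = ((x - s) + (s - r)) ^ j" by simp
    also have "\<dots> = (\<Sum>k=0..j. c k * (x - s) ^ k)"
      unfolding binomial_ring c_def atLeast0AtMost by (simp add: mult_ac)
    finally have "(x - r) ^ j = (\<Sum>k=0..j. c k * (x - s) ^ k)" .
    then show ?thesis using that f[of x]
      by (simp add: trunc_pow_def sum_distrib_left power_add mult_ac)
  qed
  have "((\<lambda>x. \<Sum>k=0..j. c k * (x - s) ^ (n + k)) has_integral (F 1 - F s)) {s..1}"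
  proof (rule fundamental_theorem_of_calculus)
    fix x
    have "(F has_real_derivative (\<Sum>k=0..j. c k * (x - s) ^ (n + k))) (at x within {s..1})"
      unfolding F_def
    proof (rule DERIV_sum)
      fix k
      show "((\<lambda>x. c k * ((x - s) ^ (n + k + 1) / real (n + k + 1))) has_real_derivative
          c k * (x - s) ^ (n + k)) (at x within {s..1})"
        by (rule derivative_eq_intros refl | simp)+
    qed
    then show "(F has_vector_derivative (\<Sum>k=0..j. c k * (x - s) ^ (n + k))) (at x within {s..1})"
      by (simp add: has_real_derivative_iff_has_vector_derivative)
  qed (use assms in auto)
  then have right: "((\<lambda>x. f x * trunc_pow n s x) has_integral (F 1 - F s)) {s..1}"
    by (rule has_integral_spike_finite[where S = "{s}", rotated 2]) (simp, rule integrand)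
  have "((\<lambda>x. f x * trunc_pow n s x) has_integral (0 + (F 1 - F s))) {0..1}"
    by (rule has_integral_combine[OF assms(1,2) left right])
  moreover have "F s = 0" by (simp add: F_def)
  ultimately have "inner_L f (trunc_pow n s) = F 1"
    by (simp add: inner_L_def integral_unique)
  then show ?thesis by (simp add: F_def c_def)
qed

lemma vv_power:
  assumes "0 < t i" "t i < 1" "j \<le> n"
  shows "vv n t i j = (1 - t i) ^ (n + 1) * t i ^ j / (real n + 1)
    * hyp2F1 j (real n + 1) (real n + 2) ((t i - 1) / t i)"
proof -
  define s where "s = t i"
  have s: "s > 0" "s < 1" using assms by (auto simp: s_def)
  have "vv n t i j =
      (\<Sum>k=0..j. real (j choose k) * (s - 0) ^ (j - k) * ((1 - s) ^ (n + k + 1) / real (n + k + 1)))"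
    unfolding vv_def s_def
    by (rule inner_L_power_trunc_pow) (use assms in \<open>auto simp: tp_basis_def\<close>)
  also have "\<dots> = (\<Sum>k=0..j. (1 - s) ^ (n + 1) * s ^ j / (real n + 1) *
     (real (j choose k) * ((real n + 1) / (real n + 1 + real k)) * (- ((s - 1) / s)) ^ k))"
  proof (rule sum.cong, rule refl)
    fix k assume k: "k \<in> {0..j}"
    have "s ^ j = s ^ (j - k) * s ^ k" using k by (simp flip: power_add)
    moreover have "(- ((s - 1) / s)) ^ k = (1 - s) ^ k / s ^ k"
      by (simp flip: power_divide add: minus_divide_left)
    ultimately show "real (j choose k) * (s - 0) ^ (j - k) * ((1 - s) ^ (n + k + 1) / real (n + k + 1)) =
      (1 - s) ^ (n + 1) * s ^ j / (real n + 1) *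
     (real (j choose k) * ((real n + 1) / (real n + 1 + real k)) * (- ((s - 1) / s)) ^ k)"
      using s by (simp only: power_add) (simp add: divide_simps add_eq_0_iff)
  qed
  also have "\<dots> = (1 - s) ^ (n + 1) * s ^ j / (real n + 1)
    * hyp2F1 j (real n + 1) (real n + 1 + 1) ((s - 1) / s)"
    by (subst hyp2F1_contiguous) (auto simp: sum_distrib_left)
  finally show ?thesis by (simp add: s_def add.assoc)
qed

lemma vv_same_knot:
  assumes "n \<ge> 1" "0 < t i" "t i < 1" "i \<ge> 1"
  shows "vv n t i (n + i) = (1 - t i) ^ (2 * n + 1) / (2 * real n + 1)"
proof -
  have "vv n t i (n + i) = (\<Sum>k=0..n. real (n choose k) * (t i - t i) ^ (n - k)
      * ((1 - t i) ^ (n + k + 1) / real (n + k + 1)))"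
    unfolding vv_def
    by (rule inner_L_power_trunc_pow) (use assms in \<open>auto simp: tp_basis_def trunc_pow_def\<close>)
  also have "\<dots> = (\<Sum>k\<in>{n}. real (n choose k) * (t i - t i) ^ (n - k)
      * ((1 - t i) ^ (n + k + 1) / real (n + k + 1)))"
    by (rule sum.mono_neutral_right) (auto simp: power_0_left)
  finally show ?thesis by (simp add: mult_2[of n])
qed

lemma vv_earlier_knot:
  assumes "n \<ge> 1" "0 < t i" "t i < 1" "1 \<le> j" "t j < t i" "i \<ge> 1"
  shows "vv n t i (n + j) = vv n t i (n + i)
    * hyp2F1 n (- 2 * real n - 1) (- 2 * real n) ((t i - t j) / (t i - 1))"
proof -
  define s where "s = t i"
  have s: "s > 0" "s < 1" using assms by (auto simp: s_def)
  define d where "d = s - t j"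
  have cancel: "P * Q / N * (C * (N / M) * (D / Q)) = C * D * (P / M)"
    if "Q \<noteq> 0" "N \<noteq> 0" "M \<noteq> 0" for C D P Q M N :: real
    using that by simp
  have "vv n t i (n + j) = (\<Sum>k=0..n. real (n choose k) * (s - t j) ^ (n - k)
      * ((1 - s) ^ (n + k + 1) / real (n + k + 1)))"
    unfolding vv_def s_def
    by (rule inner_L_power_trunc_pow) (use assms in \<open>auto simp: tp_basis_def trunc_pow_def\<close>)
  \<comment> \<open>The series is in powers of \<open>t i - t j\<close>, while the expansion is in powers of \<open>1 - t i\<close>:
    reverse the order of summation.\<close>
  also have "\<dots> = (\<Sum>k=0..n. real (n choose (n - k)) * d ^ (n - (n - k))
      * ((1 - s) ^ (n + (n - k) + 1) / real (n + (n - k) + 1)))"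
    unfolding d_def[symmetric] atLeast0AtMost
    by (subst sum.nat_diff_reindex[symmetric, of _ "Suc n", simplified lessThan_Suc_atMost]) simp
  also have "\<dots> = (\<Sum>k=0..n. (1 - s) ^ (2 * n + 1) / (2 * real n + 1) *
     (real (n choose k) * ((- 2 * real n - 1) / (- 2 * real n - 1 + real k)) * (- (d / (s - 1))) ^ k))"
  proof (rule sum.cong, rule refl)
    fix k assume k: "k \<in> {0..n}"
    have "(1 - s) ^ (2 * n + 1) = (1 - s) ^ (n + (n - k) + 1) * (1 - s) ^ k"
      using k by (simp flip: power_add add: mult_2)
    moreover have "(- (d / (s - 1))) ^ k = d ^ k / (1 - s) ^ k"
      by (metis minus_diff_eq minus_divide_right power_divide)
    moreover have "n choose (n - k) = n choose k"
      using k by (simp add: binomial_symmetric[symmetric])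
    moreover have "n - (n - k) = k" using k by simp
    moreover have "(- 2 * real n - 1) / (- 2 * real n - 1 + real k)
        = (2 * real n + 1) / real (n + (n - k) + 1)"
    proof -
      have "- 2 * real n - 1 + real k = - real (n + (n - k) + 1)"
        using k by (simp add: of_nat_diff)
      moreover have "- 2 * real n - 1 = - (2 * real n + 1)" by simp
      ultimately show ?thesis by (metis minus_divide_divide)
    qed
    moreover have "(1 - s) ^ k \<noteq> 0" "2 * real n + 1 \<noteq> 0" "real (n + (n - k) + 1) \<noteq> 0" using s by auto
    ultimately show "real (n choose (n - k)) * d ^ (n - (n - k))
      * ((1 - s) ^ (n + (n - k) + 1) / real (n + (n - k) + 1)) =
      (1 - s) ^ (2 * n + 1) / (2 * real n + 1) *
     (real (n choose k) * ((- 2 * real n - 1) / (- 2 * real n - 1 + real k)) * (- (d / (s - 1))) ^ k)"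
      by (simp only: cancel not_False_eq_True)
  qed
  also have "\<dots> = (1 - s) ^ (2 * n + 1) / (2 * real n + 1)
    * hyp2F1 n (- 2 * real n - 1) (- 2 * real n - 1 + 1) (d / (s - 1))"
    by (subst hyp2F1_contiguous) (auto simp: sum_distrib_left)
  finally show ?thesis using vv_same_knot[of n t i] assms by (simp add: s_def d_def)
qed

section \<open>Shifted Legendre polynomials\<close>

text \<open>Integration by parts, \<open>k\<close> times; all boundary terms vanish because \<open>w\<close> has zeros of order at
least \<open>k\<close> at both end points.\<close>

lemma integral_poly_higher_pderiv:
  fixes f w :: "real poly"
  assumes "\<And>j. j < k \<Longrightarrow> poly ((pderiv ^^ j) w) 0 = 0" "\<And>j. j < k \<Longrightarrow> poly ((pderiv ^^ j) w) 1 = 0"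
  shows "integral {0..1} (\<lambda>x. poly f x * poly ((pderiv ^^ k) w) x) =
    (- 1) ^ k * integral {0..1} (\<lambda>x. poly ((pderiv ^^ k) f) x * poly w x)"
  using assms
proof (induction k arbitrary: f)
  case 0
  then show ?case by simp
next
  case (Suc k)
  define W where "W = (pderiv ^^ k) w"
  have W: "poly W 0 = 0" "poly W 1 = 0" using Suc.prems by (auto simp: W_def)
  have *: "((\<lambda>x. poly (pderiv (f * W)) x) has_integral (poly (f * W) 1 - poly (f * W) 0)) {0..1}"
    by (rule fundamental_theorem_of_calculus)
       (auto simp flip: has_real_derivative_iff_has_vector_derivative simp del: poly_mult
          intro: has_field_derivative_at_within)
  have cont: "(\<lambda>x. poly p x * poly q x) integrable_on {0..1}" for p q :: "real poly"
    by (intro integrable_continuous_real continuous_intros)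
  have "0 = integral {0..1} (\<lambda>x. poly (pderiv (f * W)) x)"
    using integral_unique[OF *] W by simp
  also have "\<dots> = integral {0..1} (\<lambda>x. poly f x * poly (pderiv W) x + poly (pderiv f) x * poly W x)"
    by (simp add: pderiv_mult mult_ac add.commute)
  also have "\<dots> = integral {0..1} (\<lambda>x. poly f x * poly (pderiv W) x)
      + integral {0..1} (\<lambda>x. poly (pderiv f) x * poly W x)"
    by (rule Henstock_Kurzweil_Integration.integral_add) (rule cont)+
  finally have "integral {0..1} (\<lambda>x. poly f x * poly (pderiv W) x)
      = - integral {0..1} (\<lambda>x. poly (pderiv f) x * poly W x)" by simp
  also have "integral {0..1} (\<lambda>x. poly (pderiv f) x * poly W x) =
     (- 1) ^ k * integral {0..1} (\<lambda>x. poly ((pderiv ^^ k) (pderiv f)) x * poly w x)"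
    unfolding W_def using Suc by simp
  finally show ?case by (simp add: W_def funpow_swap1)
qed

lemma power_dvd_higher_pderiv:
  fixes w :: "real poly"
  assumes "[:- a, 1:] ^ k dvd w" "j \<le> k"
  shows "[:- a, 1:] ^ (k - j) dvd (pderiv ^^ j) w"
  using assms(2)
proof (induction j)
  case 0
  then show ?case using assms(1) by simp
next
  case (Suc j)
  then have "k - j = Suc (k - Suc j)" by simp
  then obtain q where "(pderiv ^^ j) w = [:- a, 1:] ^ Suc (k - Suc j) * q"
    using Suc by (metis Suc_leD dvdE)
  then have "(pderiv ^^ Suc j) w = [:- a, 1:] ^ (k - Suc j) *
      ([:- a, 1:] * pderiv q + smult (real (Suc (k - Suc j))) (pderiv [:- a, 1:] * q))"
    by (simp add: pderiv_mult pderiv_power_Suc algebra_simps del: power_Suc)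
       (simp add: algebra_simps)
  then show ?case by (metis dvd_triv_left)
qed

text \<open>The shifted Legendre polynomials as formal polynomials, through their Rodrigues formula; this
makes degrees, coefficients and iterated derivatives available algebraically.\<close>

definition legendre_kernel :: "nat \<Rightarrow> real poly" where
  "legendre_kernel k = [:1, -1:] ^ k * [:0, 1:] ^ k"

definition legendre_poly :: "nat \<Rightarrow> real poly" where
  "legendre_poly k = smult (1 / fact k) ((pderiv ^^ k) (legendre_kernel k))"

lemma poly_higher_pderiv: "(deriv ^^ k) (poly (p :: real poly)) = poly ((pderiv ^^ k) p)"
proof (induction k)
  case (Suc k)
  then show ?case by (auto intro!: ext DERIV_imp_deriv poly_DERIV)
qed simp

lemma shifted_legendre_poly: "shifted_legendre k x = poly (legendre_poly k) x"
proof -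
  have "(\<lambda>y. (1 - y) ^ k * y ^ k) = poly (legendre_kernel k)"
    by (auto simp: legendre_kernel_def)
  then show ?thesis
    by (simp add: shifted_legendre_def legendre_poly_def poly_higher_pderiv)
qed

lemma degree_legendre_kernel: "degree (legendre_kernel k) = 2 * k"
  by (simp add: legendre_kernel_def degree_mult_eq degree_power_eq)

lemma degree_legendre_poly: "degree (legendre_poly k) = k"
  by (simp add: legendre_poly_def degree_higher_pderiv degree_legendre_kernel)

lemma legendre_poly_nonzero: "legendre_poly k \<noteq> 0"
proof (cases "k = 0")
  case False
  then show ?thesis using degree_legendre_poly[of k] by auto
qed (simp add: legendre_poly_def legendre_kernel_def)

text \<open>These are the coefficients that occur in \<open>Phi\<close> (up to the factor \<open>2 k + 1\<close>) and in the inner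
sum of \<open>uu\<close>, which is thereby the inner product with a Legendre polynomial.\<close>

lemma coeff_legendre_poly:
  "coeff (legendre_poly k) q = pochhammer (- real k) q * pochhammer (real k + 1) q / (fact q)\<^sup>2"
proof (cases "q \<le> k")
  case True
  have "legendre_kernel k = monom 1 k * [:1, -1:] ^ k"
    by (simp add: legendre_kernel_def monom_altdef mult.commute)
  then have "coeff (legendre_kernel k) (q + k) = real (k choose q) * (- 1) ^ q"
    using True by (simp add: coeff_monom_mult coeff_linear_poly_power)
  then have "coeff (legendre_poly k) q =
      pochhammer (real q + 1) k / fact k * (real (k choose q) * (- 1) ^ q)"
    by (simp add: legendre_poly_def coeff_higher_pderiv add.commute)
  also have "pochhammer (real q + 1) k = fact (q + k) / fact q"
    using pochhammer_product'[of "1::real" q k]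
    by (simp add: add.commute flip: pochhammer_fact)
  also have "fact (q + k) / fact q / fact k = pochhammer (real k + 1) q / (fact q :: real)"
    using pochhammer_product'[of "1::real" k q]
    by (simp add: add.commute flip: pochhammer_fact)
  also have "real (k choose q) * (- 1) ^ q = pochhammer (- real k) q / fact q"
    using pochhammer_minus_of_nat_over_fact[of k q] by (simp add: mult.commute)
  finally show ?thesis by (simp add: power2_eq_square)
next
  case False
  then have "pochhammer (- real k) q = 0"
    by (simp add: pochhammer_of_nat_eq_0_iff)
  moreover have "coeff (legendre_poly k) q = 0"
    using False by (simp add: coeff_eq_0 degree_legendre_poly)
  ultimately show ?thesis by simp
qed

text \<open>Euler's Beta integral at \<open>(k + 1, k + 1)\<close>.\<close>

lemma integral_legendre_kernel:
  "integral {0..1} (poly (legendre_kernel k)) = (fact k)\<^sup>2 / fact (2 * k + 1)"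
proof -
  have "((\<lambda>x::real. x powr (real (k + 1) - 1) * (1 - x) powr (real (k + 1) - 1)) has_integral
      Beta (real (k + 1)) (real (k + 1))) {0..1}"
    by (rule has_integral_Beta_real) auto
  then have "(poly (legendre_kernel k) has_integral Beta (real (k + 1)) (real (k + 1))) {0..1}"
    by (rule has_integral_spike_finite[of "{0, 1}", rotated 2])
       (auto simp: legendre_kernel_def powr_realpow)
  moreover have "Beta (real (k + 1)) (real (k + 1)) = (fact k)\<^sup>2 / fact (2 * k + 1)"
  proof -
    have "Gamma (real (k + 1)) = fact k"
      using Gamma_fact[of k, where 'a = real] by (simp add: add.commute)
    moreover have "real (k + 1) + real (k + 1) = 1 + real (2 * k + 1)" by simp
    then have "Gamma (real (k + 1) + real (k + 1)) = fact (2 * k + 1)"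
      by (simp only: Gamma_fact)
    ultimately show ?thesis by (simp only: Beta_def power2_eq_square)
  qed
  ultimately show ?thesis by (simp add: integral_unique)
qed

text \<open>Integrating by parts \<open>k\<close> times moves all derivatives of the Rodrigues formula onto \<open>p\<close>, which
leaves the constant \<open>k! * coeff p k\<close> times a Beta integral.  For \<open>degree p < k\<close> this is the
orthogonality relation, for \<open>degree p = k\<close> it gives the norm.\<close>

lemma integral_poly_legendre:
  assumes "degree p \<le> k"
  shows "integral {0..1} (\<lambda>x. poly p x * poly (legendre_poly k) x) =
    (- 1) ^ k * coeff p k * (fact k)\<^sup>2 / fact (2 * k + 1)"
proof -
  let ?w = "legendre_kernel k"
  have vanish: "poly ((pderiv ^^ j) ?w) a = 0" if "j < k" "a \<in> {0, 1}" for j a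
  proof -
    have "[:- a, 1:] ^ k dvd ?w"
    proof (cases "a = 0")
      case False
      have "[:1, -1:] = - [:- 1, 1::real:]" by simp
      then have "[:-1, 1:] ^ k dvd [:1, -1::real:] ^ k"
        by (metis dvd_minus_iff dvd_power_same dvd_refl)
      then show ?thesis using False that by (auto simp: legendre_kernel_def)
    qed (simp add: legendre_kernel_def)
    then have "[:- a, 1:] ^ (k - j) dvd (pderiv ^^ j) ?w"
      using that by (intro power_dvd_higher_pderiv) auto
    then have "[:- a, 1:] dvd (pderiv ^^ j) ?w"
      using that by (meson dvd_power dvd_trans zero_less_diff)
    then show ?thesis by (simp add: poly_eq_0_iff_dvd)
  qed
  have "degree ((pderiv ^^ k) p) = 0"
    using assms by (simp add: degree_higher_pderiv)
  then have const: "(pderiv ^^ k) p = [:fact k * coeff p k:]"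
  proof -
    obtain c where c: "(pderiv ^^ k) p = [:c:]"
      using \<open>degree ((pderiv ^^ k) p) = 0\<close> by (rule degree_eq_zeroE)
    then have "c = coeff ((pderiv ^^ k) p) 0" by simp
    also have "\<dots> = fact k * coeff p k"
      by (simp add: coeff_higher_pderiv flip: pochhammer_fact)
    finally show ?thesis by (simp add: c)
  qed
  have "integral {0..1} (\<lambda>x. poly p x * poly (legendre_poly k) x) =
      1 / fact k * integral {0..1} (\<lambda>x. poly p x * poly ((pderiv ^^ k) ?w) x)"
    by (simp add: legendre_poly_def flip: integral_mult_right)
  also have "integral {0..1} (\<lambda>x. poly p x * poly ((pderiv ^^ k) ?w) x)
    = (- 1) ^ k * integral {0..1} (\<lambda>x. poly ((pderiv ^^ k) p) x * poly ?w x)"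
    by (rule integral_poly_higher_pderiv) (auto intro: vanish)
  also have "\<dots> = (- 1) ^ k * (fact k * coeff p k * integral {0..1} (poly ?w))"
    by (simp add: const)
  finally show ?thesis by (simp add: integral_legendre_kernel)
qed

lemma legendre_orthogonal:
  "integral {0..1} (\<lambda>x. poly (legendre_poly k) x * poly (legendre_poly l) x) =
    (if k = l then 1 / (2 * real k + 1) else 0)"
proof -
  have less: "integral {0..1} (\<lambda>x. poly (legendre_poly k) x * poly (legendre_poly l) x) = 0"
    if "k < l" for k l
    using that by (simp add: integral_poly_legendre degree_legendre_poly coeff_eq_0)
  have "coeff (legendre_poly k) k = (- 1) ^ k * fact (2 * k) / (fact k)\<^sup>2"
    using pochhammer_product'[of "1::real" k k] pochhammer_same[of k, where 'a = real]
    by (simp add: coeff_legendre_poly pochhammer_fact add.commute mult_2)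
  then have "integral {0..1} (\<lambda>x. poly (legendre_poly k) x * poly (legendre_poly k) x) =
      fact (2 * k) / fact (2 * k + 1)"
    by (simp add: integral_poly_legendre degree_legendre_poly flip: power_add)
  also have "\<dots> = 1 / (2 * real k + 1)"
  proof -
    have "fact (2 * k + 1) = (2 * real k + 1) * fact (2 * k)" by simp
    then show ?thesis by (simp only:) simp
  qed
  finally show ?thesis
    using less[of k l] less[of l k] by (cases k l rule: linorder_cases) (simp_all add: mult.commute)
qed

section \<open>The inner product on continuous functions\<close>

lemma inner_L_commute: "inner_L f g = inner_L g f"
  by (simp add: inner_L_def mult.commute)

lemma inner_L_mult_right: "inner_L f (\<lambda>x. c * g x) = c * inner_L f g"
  unfolding inner_L_def by (simp add: mult.left_commute[of _ c])

lemma integrable_mult_continuous: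
  fixes f g :: "real \<Rightarrow> real"
  assumes "continuous_on {0..1} f" "continuous_on {0..1} g"
  shows "(\<lambda>x. f x * g x) integrable_on {0..1}"
  using assms by (intro integrable_continuous_real continuous_on_mult)

lemma inner_L_add_right:
  assumes "continuous_on {0..1} f" "continuous_on {0..1} g" "continuous_on {0..1} h"
  shows "inner_L f (\<lambda>x. g x + h x) = inner_L f g + inner_L f h"
  unfolding inner_L_def using assms
  by (simp add: distrib_left integrable_mult_continuous Henstock_Kurzweil_Integration.integral_add)

lemma inner_L_diff_right:
  assumes "continuous_on {0..1} f" "continuous_on {0..1} g" "continuous_on {0..1} h"
  shows "inner_L f (\<lambda>x. g x - h x) = inner_L f g - inner_L f h"
  unfolding inner_L_def using assms
  by (simp add: right_diff_distrib integrable_mult_continuous Henstock_Kurzweil_Integration.integral_diff)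

lemma inner_L_lincomb_right:
  assumes "continuous_on {0..1} f" "\<And>a. a \<in> A \<Longrightarrow> continuous_on {0..1} (g a)" "finite A"
  shows "inner_L f (\<lambda>x. \<Sum>a\<in>A. c a * g a x) = (\<Sum>a\<in>A. c a * inner_L f (g a))"
proof -
  have "inner_L f (\<lambda>x. \<Sum>a\<in>A. c a * g a x) = integral {0..1} (\<lambda>x. \<Sum>a\<in>A. c a * (f x * g a x))"
    unfolding inner_L_def by (simp add: sum_distrib_left mult.left_commute)
  also have "\<dots> = (\<Sum>a\<in>A. integral {0..1} (\<lambda>x. c a * (f x * g a x)))"
    using assms by (intro integral_sum integrable_on_mult_right integrable_mult_continuous) auto
  finally show ?thesis by (simp add: inner_L_def)
qed

lemma inner_L_lincomb_left:
  assumes "continuous_on {0..1} f" "\<And>a. a \<in> A \<Longrightarrow> continuous_on {0..1} (g a)" "finite A"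
  shows "inner_L (\<lambda>x. \<Sum>a\<in>A. c a * g a x) f = (\<Sum>a\<in>A. c a * inner_L (g a) f)"
  using inner_L_lincomb_right[OF assms] by (simp add: inner_L_commute)

lemma inner_L_self_eq_0:
  assumes "continuous_on {0..1} f" "inner_L f f = 0" "x \<in> {0..1}"
  shows "f x = 0"
proof -
  have "integral {0..1} (\<lambda>x. f x * f x) = 0 \<longleftrightarrow> (\<forall>x\<in>{0..1}. f x * f x = 0)"
    by (rule integral_eq_0_iff) (auto intro!: continuous_intros assms)
  then show ?thesis using assms by (simp add: inner_L_def)
qed

section \<open>Biorthogonal systems in an inner product space of functions\<close>

lemma span_lincomb:
  assumes "\<And>a. a \<in> A \<Longrightarrow> g a \<in> rfun.span B"
  shows "(\<lambda>x. \<Sum>a\<in>A. c a * g a x) \<in> rfun.span B"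
  using assms
proof (induction A rule: infinite_finite_induct)
  case (insert a A)
  have "(\<lambda>x. \<Sum>a\<in>insert a A. c a * g a x) = rfun_scale (c a) (g a) + (\<lambda>x. \<Sum>a\<in>A. c a * g a x)"
    using insert.hyps by (simp add: fun_eq_iff rfun_scale_def)
  then show ?case using insert by (simp add: rfun.span_add rfun.span_scale)
qed (use rfun.span_zero[of B] in \<open>auto simp: zero_fun_def\<close>)

lemma span_add_fun:
  assumes "f \<in> rfun.span B" "g \<in> rfun.span B"
  shows "(\<lambda>x. f x + g x) \<in> rfun.span B"
  using rfun.span_add[OF assms] by (simp add: plus_fun_def)

text \<open>One Gram-Schmidt step for a biorthogonal system.  When the \<open>d l\<close> lie in the
span of the old \<open>b l\<close>, the sum in \<open>new\<close> is the orthogonal projection of the new function and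
\<open>\<kappa>\<close> is the reciprocal of the squared norm of the residual.\<close>

lemma biorthogonal_extend:
  fixes b d d' :: "nat \<Rightarrow> real \<Rightarrow> real"
  assumes cont: "\<And>l. continuous_on {0..1} (b l)" "\<And>l. continuous_on {0..1} (d l)"
    and bi: "\<And>l j. l \<le> N \<Longrightarrow> j \<le> N \<Longrightarrow> inner_L (b l) (d j) = (if l = j then 1 else 0)"
    and new: "d' (Suc N) =
      (\<lambda>x. \<kappa> * (b (Suc N) x - (\<Sum>l=0..N. inner_L (b l) (b (Suc N)) * d l x)))"
    and old: "\<And>j. j \<le> N \<Longrightarrow> d' j = (\<lambda>x. d j x - inner_L (d j) (b (Suc N)) * d' (Suc N) x)"
    and \<kappa>: "\<kappa> * (inner_L (b (Suc N)) (b (Suc N))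
      - (\<Sum>l=0..N. inner_L (b l) (b (Suc N)) * inner_L (d l) (b (Suc N)))) = 1"
    and le: "l \<le> Suc N" "j \<le> Suc N"
  shows "inner_L (b l) (d' j) = (if l = j then 1 else 0)"
proof -
  let ?v = "\<lambda>l. inner_L (b l) (b (Suc N))"
  have new': "inner_L (b l) (d' (Suc N)) = \<kappa> * (?v l - (\<Sum>a=0..N. ?v a * inner_L (b l) (d a)))" for l
    unfolding new inner_L_mult_right
    by (subst inner_L_diff_right, (intro continuous_intros cont)+,
        subst inner_L_lincomb_right) (auto intro: cont)
  have last: "inner_L (b l) (d' (Suc N)) = (if l = Suc N then 1 else 0)" if "l \<le> Suc N" for l
  proof (cases "l = Suc N")
    case True
    then show ?thesis using \<kappa> new'[of l] by (simp add: inner_L_commute)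
  next
    case False
    with that have "l \<le> N" by simp
    then have "(\<Sum>a=0..N. ?v a * inner_L (b l) (d a)) = (\<Sum>a=0..N. if a = l then ?v l else 0)"
      by (intro sum.cong) (auto simp: bi)
    then show ?thesis using new'[of l] \<open>l \<le> N\<close> by simp
  qed
  have cont': "continuous_on {0..1} (d' (Suc N))"
    unfolding new by (intro continuous_intros cont)
  show ?thesis
  proof (cases "j = Suc N")
    case True
    then show ?thesis using last le by simp
  next
    case False
    with le have j: "j \<le> N" by simp
    have "inner_L (b l) (d' j) =
        inner_L (b l) (d j) - inner_L (d j) (b (Suc N)) * inner_L (b l) (d' (Suc N))"
      unfolding old[OF j]
      by (subst inner_L_diff_right) (auto intro!: continuous_intros cont cont' simp: inner_L_mult_right)
    then show ?thesis
      using j le last[of l] bi[of l j] by (auto simp: inner_L_commute le_Suc_eq)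
  qed
qed

text \<open>The quantity is \<open>inner_L w w\<close> for the residual \<open>w = g - p\<close>, where \<open>p\<close> is the orthogonal
projection of \<open>g\<close>; if it vanished, \<open>g\<close> would agree with \<open>p\<close> on the whole interval.\<close>

lemma residual_nonzero:
  fixes b d :: "nat \<Rightarrow> real \<Rightarrow> real" and g :: "real \<Rightarrow> real"
  assumes cont: "\<And>l. continuous_on {0..1} (b l)" "\<And>l. continuous_on {0..1} (d l)"
      "continuous_on {0..1} g"
    and bi: "\<And>l j. l \<le> N \<Longrightarrow> j \<le> N \<Longrightarrow> inner_L (b l) (d j) = (if l = j then 1 else 0)"
    and span: "\<And>l. l \<le> N \<Longrightarrow> d l \<in> rfun.span (b ` {0..N})"
    and indep: "\<And>f. f \<in> rfun.span (b ` {0..N}) \<Longrightarrow> \<exists>x\<in>{0..1}. g x \<noteq> f x"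
  shows "inner_L g g - (\<Sum>l=0..N. inner_L (b l) g * inner_L (d l) g) \<noteq> 0"
proof
  define p where "p = (\<lambda>x. \<Sum>l=0..N. inner_L (b l) g * d l x)"
  define w where "w = (\<lambda>x. g x - p x)"
  assume "inner_L g g - (\<Sum>l=0..N. inner_L (b l) g * inner_L (d l) g) = 0"
  moreover have "inner_L g p = (\<Sum>l=0..N. inner_L (b l) g * inner_L (d l) g)"
    unfolding p_def by (subst inner_L_lincomb_right) (auto intro: cont simp: inner_L_commute)
  moreover have cont_p: "continuous_on {0..1} p"
    unfolding p_def by (intro continuous_intros cont)
  ultimately have gw: "inner_L g w = 0"
    unfolding w_def by (simp add: inner_L_diff_right cont)
  have cont_w: "continuous_on {0..1} w"
    unfolding w_def by (intro continuous_intros cont cont_p)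
  have bw: "inner_L (b l) w = 0" if "l \<le> N" for l
  proof -
    have "inner_L (b l) p = (\<Sum>a=0..N. inner_L (b a) g * inner_L (b l) (d a))"
      unfolding p_def by (rule inner_L_lincomb_right) (auto intro: cont)
    also have "\<dots> = (\<Sum>a=0..N. if a = l then inner_L (b l) g else 0)"
      using that by (intro sum.cong) (auto simp: bi)
    finally have "inner_L (b l) p = inner_L (b l) g" using that by simp
    then show ?thesis unfolding w_def by (simp add: inner_L_diff_right cont cont_p)
  qed
  have p_span: "p \<in> rfun.span (b ` {0..N})"
    unfolding p_def by (rule span_lincomb) (auto intro: span)
  have "inner_L w f = 0 \<and> continuous_on {0..1} f" if "f \<in> rfun.span (b ` {0..N})" for f
    using that
  proof (induction f rule: rfun.span_induct_alt)
    case base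
    then show ?case by (simp add: inner_L_def zero_fun_def)
  next
    case (step c f h)
    then obtain l where l: "l \<le> N" "f = b l" by auto
    have "rfun_scale c f + h = (\<lambda>x. c * f x + h x)" by (simp add: rfun_scale_def fun_eq_iff)
    moreover have "inner_L w (\<lambda>x. c * f x + h x) = c * inner_L w f + inner_L w h"
      using step l by (subst inner_L_add_right)
        (auto intro!: continuous_intros cont cont_w simp: inner_L_mult_right)
    moreover have "continuous_on {0..1} (\<lambda>x. c * f x + h x)"
      using step l by (auto intro!: continuous_intros cont)
    ultimately show ?case using bw[OF l(1)] step l by (simp add: inner_L_commute)
  qed
  then have "inner_L w p = 0" using p_span by blast
  moreover have "inner_L w w = inner_L w g - inner_L w p"
    using inner_L_diff_right[OF cont_w cont(3) cont_p] by (simp add: w_def)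
  ultimately have "inner_L w w = 0" using gw by (simp add: inner_L_commute)
  then have "g x = p x" if "x \<in> {0..1}" for x
    using inner_L_self_eq_0[OF cont_w _ that] by (simp add: w_def)
  then show False using indep[OF p_span] by blast
qed

lemma sum_apply:
  fixes F :: "'a \<Rightarrow> 'b \<Rightarrow> 'c :: comm_monoid_add"
  shows "(\<Sum>a\<in>A. F a) x = (\<Sum>a\<in>A. F a x)"
  by (induction A rule: infinite_finite_induct) auto

text \<open>Biorthogonality makes the \<open>d j\<close> linearly independent, and there are as many of them as the
\<open>b l\<close> whose span contains them, so no \<open>b l\<close> can lie outside their span.  Equality holds for
functions on the whole real line, although the inner product only sees \<open>[0, 1]\<close>.\<close>

lemma span_eq_of_biorthogonal:
  fixes b d :: "nat \<Rightarrow> real \<Rightarrow> real"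
  assumes cont: "\<And>l. continuous_on {0..1} (b l)" "\<And>l. continuous_on {0..1} (d l)"
    and bi: "\<And>l j. l \<le> N \<Longrightarrow> j \<le> N \<Longrightarrow> inner_L (b l) (d j) = (if l = j then 1 else 0)"
    and span: "\<And>l. l \<le> N \<Longrightarrow> d l \<in> rfun.span (b ` {0..N})"
  shows "rfun.span (d ` {0..N}) = rfun.span (b ` {0..N})"
proof -
  have inj: "inj_on d {0..N}"
  proof (rule inj_onI)
    fix j l assume "j \<in> {0..N}" "l \<in> {0..N}" "d j = d l"
    then show "j = l" using bi[of j j] bi[of j l] by (auto split: if_splits)
  qed
  have indep: "rfun.independent (d ` {0..N})"
  proof (rule rfun.independent_if_scalars_zero)
    fix c f assume zero: "(\<Sum>f\<in>d ` {0..N}. rfun_scale (c f) f) = 0" and "f \<in> d ` {0..N}"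
    then obtain j where j: "j \<le> N" "f = d j" by auto
    have "(\<lambda>x. \<Sum>l=0..N. c (d l) * d l x) = (\<Sum>f\<in>d ` {0..N}. rfun_scale (c f) f)"
      by (simp add: sum.reindex[OF inj] fun_eq_iff rfun_scale_def sum_apply)
    then have "(\<lambda>x. \<Sum>l=0..N. c (d l) * d l x) = (\<lambda>x. 0)"
      using zero by (simp add: zero_fun_def)
    then have "0 = inner_L (b j) (\<lambda>x. \<Sum>l=0..N. c (d l) * d l x)"
      by (simp add: inner_L_def)
    also have "\<dots> = (\<Sum>l=0..N. c (d l) * inner_L (b j) (d l))"
      by (rule inner_L_lincomb_right) (auto intro: cont)
    also have "\<dots> = (\<Sum>l=0..N. if l = j then c (d j) else 0)"
      using j by (intro sum.cong) (auto simp: bi)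
    finally show "c f = 0" using j by simp
  qed simp
  have "b l \<in> rfun.span (d ` {0..N})" if "l \<le> N" for l
  proof (rule ccontr)
    assume contra: "b l \<notin> rfun.span (d ` {0..N})"
    then have new: "b l \<notin> d ` {0..N}" using rfun.span_base by blast
    have "rfun.independent (insert (b l) (d ` {0..N}))"
      using contra indep by (rule rfun.independent_insertI)
    moreover have "insert (b l) (d ` {0..N}) \<subseteq> rfun.span (b ` {0..N})"
      using that span by (auto intro: rfun.span_base)
    ultimately have "card (insert (b l) (d ` {0..N})) \<le> card (b ` {0..N})"
      using rfun.independent_span_bound[of "b ` {0..N}"] by simp
    moreover have "card (insert (b l) (d ` {0..N})) = Suc (Suc N)"
      using new by (simp add: card_image[OF inj])
    moreover have "card (b ` {0..N}) \<le> Suc N"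
      using card_image_le[of "{0..N}" b] by simp
    ultimately show False by simp
  qed
  then show ?thesis
    by (intro antisym rfun.span_minimal rfun.subspace_span) (auto intro: span)
qed

section \<open>Independence of truncated powers\<close>

lemma spline_polynomial_past_knots:
  assumes "f \<in> rfun.span (tp_basis n t ` {0..n + i})" "\<And>h. h \<in> {1..i} \<Longrightarrow> t h \<le> s"
  shows "\<exists>p. \<forall>x>s. f x = poly p x"
  using assms(1)
proof (induction f rule: rfun.span_induct_alt)
  case base
  show ?case by (rule exI[of _ 0]) simp
next
  case (step c f g)
  obtain q where q: "\<forall>x>s. g x = poly q x" using step by blast
  obtain l where l: "l \<le> n + i" "f = tp_basis n t l" using step by auto
  have "\<exists>p. \<forall>x>s. f x = poly p x"
  proof (cases "l \<le> n")
    case True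
    then show ?thesis using l by (intro exI[of _ "monom 1 l"]) (simp add: tp_basis_def poly_monom)
  next
    case False
    then have "l - n \<in> {1..i}" using l by auto
    then have "t (l - n) \<le> s" by (rule assms(2))
    then show ?thesis using False l
      by (intro exI[of _ "[:- t (l - n), 1:] ^ n"]) (auto simp: tp_basis_def trunc_pow_def)
  qed
  then obtain p where p: "\<forall>x>s. f x = poly p x" by blast
  show ?case
    using p q by (intro exI[of _ "smult c p + q"]) (simp add: rfun_scale_def)
qed

text \<open>A spline with knots up to \<open>s\<close> is a single polynomial to the right of \<open>s\<close>.  If it agreed with
the truncated power it would vanish on \<open>(s, r)\<close>, hence everywhere to the right of \<open>s\<close>, but the
truncated power is positive at \<open>1\<close>.\<close>

lemma trunc_pow_not_spline:
  assumes f: "f \<in> rfun.span (tp_basis n t ` {0..n + i})"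
    and knots: "\<And>h. h \<in> {1..i} \<Longrightarrow> t h \<le> s" and s: "0 \<le> s" "s < r" "r < 1"
  shows "\<exists>x\<in>{0..1}. trunc_pow n r x \<noteq> f x"
proof (rule ccontr)
  assume "\<not> ?thesis"
  then have eq: "f x = trunc_pow n r x" if "x \<in> {0..1}" for x using that by auto
  obtain p where p: "\<And>x. x > s \<Longrightarrow> f x = poly p x"
    using spline_polynomial_past_knots[OF f knots] by blast
  have "poly p x = 0" if "x \<in> {s<..<r}" for x
    using that s eq[of x] p[of x] by (auto simp: trunc_pow_def)
  then have "{s<..<r} \<subseteq> {x. poly p x = 0}" by auto
  then have "p = 0"
    using s poly_roots_finite[of p] infinite_Ioo[of s r] finite_subset by blast
  then have "trunc_pow n r 1 = 0" using s eq[of 1] p[of 1] by auto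
  then show False using s by (simp add: trunc_pow_def)
qed

section \<open>The recursion in terms of functions\<close>

text \<open>The equation of \<open>cc\<close> applies to every argument, so as default rewrite rules the equations
would unfold the whole recursion.\<close>

declare Psi.simps [simp del] Lam.simps [simp del] uu.simps [simp del] cc_last.simps [simp del]
  cc.simps [simp del]

text \<open>For \<open>n = 0\<close> the truncated power jumps at its knot.  Continuity is what turns a vanishing norm
into pointwise vanishing on \<open>[0, 1]\<close>.\<close>

lemma continuous_on_trunc_pow:
  assumes "n \<ge> 1"
  shows "continuous_on S (trunc_pow n s)"
proof -
  have "trunc_pow n s = (\<lambda>x. (max 0 (x - s)) ^ n)"
    using assms by (auto simp: trunc_pow_def max_def fun_eq_iff)
  then show ?thesis by (auto intro!: continuous_intros)
qed

lemma continuous_on_tp_basis: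
  assumes "n \<ge> 1"
  shows "continuous_on S (tp_basis n t l)"
  using assms by (auto simp: tp_basis_def intro!: continuous_intros continuous_on_trunc_pow)

lemma continuous_on_shifted_legendre: "continuous_on S (shifted_legendre k)"
  unfolding shifted_legendre_poly[abs_def] by (intro continuous_intros)

lemma continuous_on_dual_fun:
  assumes "n \<ge> 1"
  shows "continuous_on S (dual_fun n t i j)"
  unfolding dual_fun_def[abs_def]
  by (intro continuous_intros continuous_on_shifted_legendre continuous_on_trunc_pow assms)

lemma shifted_legendre_expand:
  "shifted_legendre k = (\<lambda>x. \<Sum>q=0..k. coeff (legendre_poly k) q * x ^ q)"
  by (simp add: fun_eq_iff shifted_legendre_poly poly_altdef degree_legendre_poly atLeast0AtMost)

lemma dual_fun_in_span: "dual_fun n t i j \<in> rfun.span (tp_basis n t ` {0..n + i})"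
proof -
  let ?S = "rfun.span (tp_basis n t ` {0..n + i})"
  have "shifted_legendre k \<in> ?S" if "k \<le> n" for k
    unfolding shifted_legendre_expand
  proof (rule span_lincomb)
    fix q assume "q \<in> {0..k}"
    then have "(\<lambda>x. x ^ q) = tp_basis n t q" "q \<in> {0..n + i}"
      using that by (auto simp: tp_basis_def)
    then show "(\<lambda>x. x ^ q) \<in> ?S" by (metis imageI rfun.span_base)
  qed
  moreover have "trunc_pow n (t h) \<in> ?S" if "h \<in> {1..i}" for h
  proof -
    have "trunc_pow n (t h) = tp_basis n t (n + h)" "n + h \<in> {0..n + i}"
      using that by (auto simp: tp_basis_def)
    then show ?thesis by (metis imageI rfun.span_base)
  qed
  ultimately show ?thesis
    unfolding dual_fun_def[abs_def] by (intro span_add_fun span_lincomb) auto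
qed

text \<open>The coefficients \<open>uu\<close> are the inner products of the next truncated power with the current dual
functions, evaluated through the table \<open>vv\<close>.\<close>

lemma uu_eq_inner_L:
  assumes "n \<ge> 1"
  shows "uu n t (Suc i) j = inner_L (dual_fun n t i j) (trunc_pow n (t (Suc i)))"
proof -
  let ?g = "trunc_pow n (t (Suc i))"
  note cont = continuous_on_trunc_pow[OF assms] continuous_on_shifted_legendre
  have L: "inner_L ?g (shifted_legendre k) =
      (\<Sum>q=0..k. coeff (legendre_poly k) q * vv n t (Suc i) q)" if "k \<le> n" for k
  proof -
    have "inner_L ?g (shifted_legendre k) =
        (\<Sum>q=0..k. coeff (legendre_poly k) q * inner_L ?g (\<lambda>x. x ^ q))"
      unfolding shifted_legendre_expand
      by (rule inner_L_lincomb_right) (auto intro!: continuous_intros cont)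
    also have "\<dots> = (\<Sum>q=0..k. coeff (legendre_poly k) q * vv n t (Suc i) q)"
      by (rule sum.cong) (use that in \<open>auto simp: vv_def tp_basis_def inner_L_commute\<close>)
    finally show ?thesis .
  qed
  have T: "inner_L ?g (trunc_pow n (t h)) = vv n t (Suc i) (n + h)" if "h \<ge> 1" for h
    using that by (simp add: vv_def tp_basis_def inner_L_commute)
  have "inner_L ?g (dual_fun n t i j) =
      inner_L ?g (\<lambda>x. \<Sum>k=0..n. Psi n t i k j * shifted_legendre k x)
      + inner_L ?g (\<lambda>x. \<Sum>h=1..i. Lam n t i h j * trunc_pow n (t h) x)"
    unfolding dual_fun_def[abs_def]
    by (rule inner_L_add_right) (intro continuous_intros cont)+
  also have "\<dots> = (\<Sum>k=0..n. Psi n t i k j * inner_L ?g (shifted_legendre k))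
      + (\<Sum>h=1..i. Lam n t i h j * inner_L ?g (trunc_pow n (t h)))"
    by (subst (1 2) inner_L_lincomb_right) (auto intro!: cont)
  also have "\<dots> = uu n t (Suc i) j"
    by (simp add: uu.simps L T flip: coeff_legendre_poly)
  finally show ?thesis by (simp add: inner_L_commute)
qed

text \<open>Up to the normalisation \<open>cc_last\<close>, the new dual function is the component of the new truncated
power orthogonal to the current spline space: the sum is the orthogonal projection, written in
the dual basis.\<close>

lemma dual_fun_Suc_new:
  "dual_fun n t (Suc i) (n + Suc i) x = cc_last n t (Suc i) *
     (trunc_pow n (t (Suc i)) x - (\<Sum>l=0..n+i. vv n t (Suc i) l * dual_fun n t i l x))"
proof -
  let ?c = "cc n t (Suc i)"
  have "dual_fun n t (Suc i) (n + Suc i) x =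
      (\<Sum>k=0..n. (\<Sum>l=0..n+i. ?c l * Psi n t i k l) * shifted_legendre k x)
      + (\<Sum>h=1..i. (\<Sum>l=0..n+i. ?c l * Lam n t i h l) * trunc_pow n (t h) x)
      + cc_last n t (Suc i) * trunc_pow n (t (Suc i)) x"
    by (simp add: dual_fun_def Psi.simps Lam.simps cc.simps[of n t "Suc i" "n + Suc i"]
          cc.simps[of n t "Suc i" "Suc (n + i)"])
  also have "(\<Sum>k=0..n. (\<Sum>l=0..n+i. ?c l * Psi n t i k l) * shifted_legendre k x) =
      (\<Sum>l=0..n+i. ?c l * (\<Sum>k=0..n. Psi n t i k l * shifted_legendre k x))"
    by (simp add: sum_distrib_left sum_distrib_right mult.assoc) (rule sum.swap)
  also have "(\<Sum>h=1..i. (\<Sum>l=0..n+i. ?c l * Lam n t i h l) * trunc_pow n (t h) x) =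
      (\<Sum>l=0..n+i. ?c l * (\<Sum>h=1..i. Lam n t i h l * trunc_pow n (t h) x))"
    by (simp add: sum_distrib_left sum_distrib_right mult.assoc) (rule sum.swap)
  also have "(\<Sum>l=0..n+i. ?c l * (\<Sum>k=0..n. Psi n t i k l * shifted_legendre k x))
      + (\<Sum>l=0..n+i. ?c l * (\<Sum>h=1..i. Lam n t i h l * trunc_pow n (t h) x))
      = (\<Sum>l=0..n+i. ?c l * dual_fun n t i l x)"
    by (simp add: dual_fun_def distrib_left sum.distrib)
  also have "\<dots> = (\<Sum>l=0..n+i. - (cc_last n t (Suc i) * (vv n t (Suc i) l * dual_fun n t i l x)))"
    by (rule sum.cong) (auto simp: cc.simps)
  finally show ?thesis
    by (simp add: right_diff_distrib sum_distrib_left sum_negf)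
qed

text \<open>The old dual functions are corrected by a multiple of the new one, chosen to make them orthogonal
to the new truncated power.\<close>

lemma dual_fun_Suc_old:
  assumes "j \<le> n + i"
  shows "dual_fun n t (Suc i) j x =
    dual_fun n t i j x - uu n t (Suc i) j * dual_fun n t (Suc i) (n + Suc i) x"
proof -
  have Psi: "Psi n t (Suc i) k j =
      Psi n t i k j - uu n t (Suc i) j * Psi n t (Suc i) k (n + Suc i)" for k
    using assms by (simp add: Psi.simps)
  have Lam: "Lam n t (Suc i) h j =
      (if h \<le> i then Lam n t i h j else 0) - uu n t (Suc i) j * Lam n t (Suc i) h (n + Suc i)"
    if "h \<le> Suc i" for h
    using assms that by (auto simp: Lam.simps)
  have "(\<Sum>h=1..Suc i. Lam n t (Suc i) h j * trunc_pow n (t h) x) =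
     (\<Sum>h=1..Suc i. ((if h \<le> i then Lam n t i h j else 0)
        - uu n t (Suc i) j * Lam n t (Suc i) h (n + Suc i)) * trunc_pow n (t h) x)"
    by (rule sum.cong) (use Lam in auto)
  also have "\<dots> = (\<Sum>h=1..Suc i. (if h \<le> i then Lam n t i h j else 0) * trunc_pow n (t h) x)
      - uu n t (Suc i) j * (\<Sum>h=1..Suc i. Lam n t (Suc i) h (n + Suc i) * trunc_pow n (t h) x)"
    by (simp only: left_diff_distrib sum_subtractf sum_distrib_left mult.assoc)
  also have "(\<Sum>h=1..Suc i. (if h \<le> i then Lam n t i h j else 0) * trunc_pow n (t h) x)
      = (\<Sum>h=1..i. Lam n t i h j * trunc_pow n (t h) x)"
    by simp
  finally have L: "(\<Sum>h=1..Suc i. Lam n t (Suc i) h j * trunc_pow n (t h) x) =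
      (\<Sum>h=1..i. Lam n t i h j * trunc_pow n (t h) x)
      - uu n t (Suc i) j * (\<Sum>h=1..Suc i. Lam n t (Suc i) h (n + Suc i) * trunc_pow n (t h) x)" .
  have P: "(\<Sum>k=0..n. Psi n t (Suc i) k j * shifted_legendre k x) =
     (\<Sum>k=0..n. Psi n t i k j * shifted_legendre k x)
      - uu n t (Suc i) j * (\<Sum>k=0..n. Psi n t (Suc i) k (n + Suc i) * shifted_legendre k x)"
    unfolding Psi by (simp only: left_diff_distrib sum_subtractf sum_distrib_left mult.assoc)
  show ?thesis unfolding dual_fun_def L P by (simp only: distrib_left)
qed

section \<open>Biorthogonality and the dual basis\<close>

text \<open>Let \<open>c\<close> be the lower triangular matrix of Legendre coefficients and \<open>M\<close> the matrix of the inner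
products in question.  Pairing the Legendre polynomial \<open>L\<^sub>m\<close> with the dual functions, which are
combinations of Legendre polynomials, and using orthogonality gives \<open>c M = c\<close>.  As the diagonal
of \<open>c\<close> has no zeros, \<open>M\<close> is the identity, row by row.\<close>

lemma dual_fun_0_biorthogonal:
  assumes "n \<ge> 1" "l \<le> n"
  shows "inner_L (tp_basis n t l) (dual_fun n t 0 j) = (if l = j then 1 else 0)"
  using assms(2)
proof (induction l rule: less_induct)
  case (less m)
  let ?c = "\<lambda>k. coeff (legendre_poly k)"
  let ?M = "\<lambda>l. inner_L (\<lambda>x. x ^ l) (dual_fun n t 0 j)"
  have tp: "tp_basis n t l = (\<lambda>x. x ^ l)" if "l \<le> m" for l
    using that less.prems by (simp add: tp_basis_def)
  have "inner_L (shifted_legendre m) (dual_fun n t 0 j) =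
      (\<Sum>k=0..n. Phi k j * inner_L (shifted_legendre m) (shifted_legendre k))"
    unfolding dual_fun_def[abs_def]
    by (simp add: Psi.simps inner_L_lincomb_right continuous_on_shifted_legendre)
  also have "\<dots> = (\<Sum>k=0..n. if m = k then Phi m j / (2 * real m + 1) else 0)"
    by (rule sum.cong) (auto simp: inner_L_def shifted_legendre_poly legendre_orthogonal)
  also have "\<dots> = ?c m j"
    using less.prems by (simp add: Phi_def coeff_legendre_poly)
  finally have "?c m j = (\<Sum>l=0..m. ?c m l * ?M l)"
    unfolding shifted_legendre_expand
    by (subst (asm) inner_L_lincomb_left)
       (auto intro!: continuous_intros continuous_on_dual_fun assms)
  also have "\<dots> = (\<Sum>l<m. ?c m l * ?M l) + ?c m m * ?M m"
    by (simp add: atLeast0AtMost flip: lessThan_Suc_atMost)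
  also have "(\<Sum>l<m. ?c m l * ?M l) = (\<Sum>l<m. if l = j then ?c m j else 0)"
  proof (rule sum.cong, rule refl)
    fix l assume "l \<in> {..<m}"
    then show "?c m l * ?M l = (if l = j then ?c m j else 0)"
      using less.IH[of l] less.prems tp[of l] by auto
  qed
  also have "\<dots> = (if j < m then ?c m j else 0)" by simp
  finally have *: "?c m j = (if j < m then ?c m j else 0) + ?c m m * ?M m" .
  have "?c m m \<noteq> 0"
    by (metis degree_legendre_poly leading_coeff_0_iff legendre_poly_nonzero)
  moreover have "?c m j = 0" if "j > m"
    using that by (simp add: coeff_eq_0 degree_legendre_poly)
  ultimately show ?case
    using * tp[of m] by (cases j m rule: linorder_cases) auto
qed

text \<open>The abstract extension step applied to the recursion.  The bound \<open>s\<close> stands for the last knot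
already used, or for \<open>0\<close> if there is none.\<close>

lemma dual_fun_Suc_biorthogonal:
  assumes n: "n \<ge> 1"
    and bi: "\<And>l j. l \<le> n + i \<Longrightarrow> j \<le> n + i \<Longrightarrow>
      inner_L (tp_basis n t l) (dual_fun n t i j) = (if l = j then 1 else 0)"
    and knots: "\<And>h. h \<in> {1..i} \<Longrightarrow> t h \<le> s" and s: "0 \<le> s" "s < t (Suc i)" "t (Suc i) < 1"
    and le: "l \<le> n + Suc i" "j \<le> n + Suc i"
  shows "inner_L (tp_basis n t l) (dual_fun n t (Suc i) j) = (if l = j then 1 else 0)"
proof -
  let ?b = "tp_basis n t" and ?d = "dual_fun n t i" and ?g = "trunc_pow n (t (Suc i))"
  have g: "?b (Suc (n + i)) = ?g" by (simp add: tp_basis_def)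
  note cont = continuous_on_tp_basis[OF n] continuous_on_dual_fun[OF n] continuous_on_trunc_pow[OF n]
  have nz: "inner_L ?g ?g - (\<Sum>l=0..n+i. inner_L (?b l) ?g * inner_L (?d l) ?g) \<noteq> 0"
    by (rule residual_nonzero)
       (auto intro: cont dual_fun_in_span trunc_pow_not_spline[OF _ knots s] simp: bi)
  have \<kappa>: "cc_last n t (Suc i) *
      (inner_L ?g ?g - (\<Sum>l=0..n+i. inner_L (?b l) ?g * inner_L (?d l) ?g)) = 1"
    using nz by (simp add: cc_last.simps uu_eq_inner_L[OF n] vv_def g)
  show ?thesis
  proof (rule biorthogonal_extend[where N = "n + i" and d = ?d and \<kappa> = "cc_last n t (Suc i)"])
    show "dual_fun n t (Suc i) (Suc (n + i)) = (\<lambda>x. cc_last n t (Suc i) *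
        (?b (Suc (n + i)) x - (\<Sum>l=0..n+i. inner_L (?b l) (?b (Suc (n + i))) * ?d l x)))"
      using dual_fun_Suc_new[of n t i] by (simp add: fun_eq_iff g vv_def)
    show "dual_fun n t (Suc i) j = (\<lambda>x. ?d j x
        - inner_L (?d j) (?b (Suc (n + i))) * dual_fun n t (Suc i) (Suc (n + i)) x)"
      if "j \<le> n + i" for j
      using dual_fun_Suc_old[OF that, of t] by (simp add: fun_eq_iff g uu_eq_inner_L[OF n])
  qed (use cont bi \<kappa> le in \<open>auto simp: g\<close>)
qed

theorem mainTheorem5:
  fixes n m :: nat and t :: "nat \<Rightarrow> real"
  assumes "n \<ge> 1" and "m \<ge> 1"
    and "0 < t 1" and "\<And>i. 1 \<le> i \<Longrightarrow> i < m \<Longrightarrow> t i < t (i + 1)" and "t m < 1"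
  shows "(\<forall>i\<in>{1..m}.
            (\<forall>j\<in>{0..n}. vv n t i j =
               (1 - t i) ^ (n + 1) * t i ^ j / (real n + 1)
                 * hyp2F1 j (real n + 1) (real n + 2) ((t i - 1) / t i))
          \<and> vv n t i (n + i) = (1 - t i) ^ (2 * n + 1) / (2 * real n + 1)
          \<and> (\<forall>j\<in>{1..<i}. vv n t i (n + j) =
               vv n t i (n + i)
                 * hyp2F1 n (- 2 * real n - 1) (- 2 * real n) ((t i - t j) / (t i - 1))))
       \<and> (\<forall>i\<in>{1..m}.
            rfun.span (dual_fun n t i ` {0..n + i}) = rfun.span (tp_basis n t ` {0..n + i})
          \<and> (\<forall>l\<in>{0..n + i}. \<forall>j\<in>{0..n + i}.
               inner_L (tp_basis n t l) (dual_fun n t i j) = (if l = j then 1 else 0)))"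
proof -
  have less: "t a < t b" if "1 \<le> a" "a < b" "b \<le> m" for a b
    using that(2,3)
  proof (induction b)
    case (Suc b)
    then show ?case using assms(4)[of b] that(1) by (cases "a = b") force+
  qed simp
  have knot: "0 < t i" "t i < 1" if "i \<in> {1..m}" for i
    using that less[of 1 i] less[of i m] assms(3,5) by (cases "i = 1"; cases "i = m"; force)+
  have bi: "inner_L (tp_basis n t l) (dual_fun n t i j) = (if l = j then 1 else 0)"
    if "i \<le> m" "l \<le> n + i" "j \<le> n + i" for i l j
    using that
  proof (induction i arbitrary: l j)
    case 0
    then show ?case using dual_fun_0_biorthogonal[OF assms(1)] by simp
  next
    case (Suc i)
    define s where "s = (if i = 0 then 0 else t i)"
    have "t h \<le> s" if "h \<in> {1..i}" for h
      using that less[of h i] Suc.prems by (cases "h = i") (auto simp: s_def)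
    moreover have "0 \<le> s" "s < t (Suc i)" "t (Suc i) < 1"
      using Suc.prems less[of i "Suc i"] knot[of i] knot[of "Suc i"] by (auto simp: s_def)
    ultimately show ?case
      using Suc.prems by (intro dual_fun_Suc_biorthogonal[OF assms(1) Suc.IH, where s = s]) auto
  qed
  have span: "rfun.span (dual_fun n t i ` {0..n + i}) = rfun.span (tp_basis n t ` {0..n + i})"
    if "i \<in> {1..m}" for i
    using that assms(1) bi
    by (intro span_eq_of_biorthogonal)
       (auto intro: continuous_on_tp_basis continuous_on_dual_fun dual_fun_in_span)
  show ?thesis
  proof (intro conjI ballI)
    fix i j assume "i \<in> {1..m}" "j \<in> {0..n}"
    then show "vv n t i j = (1 - t i) ^ (n + 1) * t i ^ j / (real n + 1)
        * hyp2F1 j (real n + 1) (real n + 2) ((t i - 1) / t i)"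
      using knot by (intro vv_power) auto
  next
    fix i assume "i \<in> {1..m}"
    then show "vv n t i (n + i) = (1 - t i) ^ (2 * n + 1) / (2 * real n + 1)"
      using knot assms(1) by (intro vv_same_knot) auto
  next
    fix i j assume "i \<in> {1..m}" "j \<in> {1..<i}"
    then show "vv n t i (n + j) = vv n t i (n + i)
        * hyp2F1 n (- 2 * real n - 1) (- 2 * real n) ((t i - t j) / (t i - 1))"
      using knot less[of j i] assms(1) by (intro vv_earlier_knot) auto
  next
    fix i l j assume "i \<in> {1..m}" "l \<in> {0..n + i}" "j \<in> {0..n + i}"
    then show "inner_L (tp_basis n t l) (dual_fun n t i j) = (if l = j then 1 else 0)"
      using bi by simp
  qed (rule span)
qed

end
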